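(* Let $S$ be a complete separable metric space with Borel $\sigma$-algebra $\mathcal S$, and let $\Pi$ be a family of probability measures on $(S,\mathcal S)$. If $\Pi$ is relatively compact, then $\Pi$ is tight.
   Context: A family $\Pi$ of probability measures on $(S,\mathcal S)$ is tight if for every $\epsilon>0$ there exists a compact set $K\subset S$ such that $P(K)>1-\epsilon$ for all $P\in\Pi$. The family $\Pi$ is relatively compact if every sequence of elements of $\Pi$ contains a subsequence converging weakly to some probability measure on $(S,\mathcal S)$ (the limit may depend on the subsequence and need not lie in $\Pi$). Weak convergence $P_n\Rightarrow P$ means $\int f\,dP_n\to\int f\,dP$ for every bounded continuous $f:S\to\mathbb R$. *)

theory Defs
  imports "HOL-Probability.Probability"
begin

text \<open>
  Probability measures on a metric space with its Borel sigma-algebra; the condition on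
  \<open>sets\<close> also forces \<open>space M = UNIV\<close>.
\<close>

definition borel_prob :: "'a::topological_space measure set" where
  "borel_prob = {M. prob_space M \<and> sets M = sets borel}"

text \<open>
  The name \<open>weak_conv_m\<close> of the library is reserved for convergence of distribution functions on
  the real line, and \<open>tight\<close> for sequences of real distributions; the following are the notions
  for general metric spaces.
\<close>

definition weakly_converges ::
    "(nat \<Rightarrow> 'a::metric_space measure) \<Rightarrow> 'a measure \<Rightarrow> bool" where
  "weakly_converges X M \<longleftrightarrow>
     (\<forall>f :: 'a \<Rightarrow> real. continuous_on UNIV f \<and> bounded (range f) \<longrightarrow>
        (\<lambda>n. \<integral>x. f x \<partial>(X n)) \<longlonglongrightarrow> (\<integral>x. f x \<partial>M))"

definition tight_family :: "'a::metric_space measure set \<Rightarrow> bool" where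
  "tight_family \<Gamma> \<longleftrightarrow>
     (\<forall>\<epsilon>>0. \<exists>K. compact K \<and> (\<forall>P\<in>\<Gamma>. measure P K > 1 - \<epsilon>))"

definition relatively_compact_family :: "'a::metric_space measure set \<Rightarrow> bool" where
  "relatively_compact_family \<Gamma> \<longleftrightarrow>
     (\<forall>X :: nat \<Rightarrow> 'a measure. (\<forall>n. X n \<in> \<Gamma>) \<longrightarrow>
        (\<exists>r Q. strict_mono r \<and> Q \<in> borel_prob \<and> weakly_converges (X \<circ> r) Q))"

end

theory Submission
  imports Defs
begin

text \<open>
  Relative compactness gives uniformity along open exhaustions: if open sets \<open>G n\<close> increase to the
  whole space, then one single \<open>G n\<close> carries almost all the mass of every member of the family
  (\<open>relatively_compact_uniform_exhaustion\<close>). Otherwise there would be measures \<open>X n\<close> in the family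
  with \<open>X n (G n) \<le> 1 - \<epsilon>\<close>; a weak limit \<open>Q\<close> of a subsequence would satisfy \<open>Q (G k) \<le> 1 - \<epsilon>\<close> for
  every \<open>k\<close>, because mass of an open set cannot appear only in the limit, and \<open>Q (G k)\<close> would not
  tend to 1.

  Separability provides, for each radius \<open>1 / (m + 1)\<close>, an exhaustion by finite unions of balls
  centred in a countable dense set. Hence finitely many balls of that radius carry all but
  \<open>\<epsilon> / 2 ^ (m + 2)\<close> of the mass, uniformly over the family. The intersection over \<open>m\<close> of the
  corresponding closed sets is closed and totally bounded, so compact by completeness, and it
  loses at most \<open>\<epsilon> / 2\<close> of the mass.
\<close>

lemma borel_probD:
  assumes "M \<in> borel_prob"
  shows "prob_space M" "sets M = sets borel" "space M = UNIV"
  using assms sets_eq_imp_space_eq[of M borel] by (auto simp: borel_prob_def)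

text \<open>
  The indicator of a proper open subset is an increasing limit of continuous functions, namely truncated
  multiples of the distance to the complement. This reduces lower semicontinuity of mass on open
  sets under weak convergence to test functions.
\<close>

lemma open_set_continuous_minorant:
  fixes U :: "'a::metric_space set"
  assumes Q: "Q \<in> borel_prob" and U: "open U" "U \<noteq> UNIV" and c: "c < measure Q U"
  obtains f :: "'a \<Rightarrow> real"
  where "continuous_on UNIV f" "\<And>x. 0 \<le> f x" "\<And>x. f x \<le> indicator U x" "c < (\<integral>x. f x \<partial>Q)"
proof -
  interpret prob_space Q using borel_probD[OF Q] by simp
  note [measurable_cong] = borel_probD(2)[OF Q]
  have [measurable]: "U \<in> sets borel" using U by simp
  define f where "f k x = min 1 (real k * infdist x (- U))" for k x
  have cont: "continuous_on UNIV (f k)" for k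
    unfolding f_def by (intro continuous_intros)
  have [measurable]: "f k \<in> borel_measurable borel" for k
    using cont by (rule borel_measurable_continuous_onI)
  have nonneg: "0 \<le> f k x" for k x
    by (simp add: f_def infdist_nonneg)
  have le: "f k x \<le> indicator U x" for k x
    by (cases "x \<in> U") (auto simp: f_def)
  have lim: "(\<lambda>k. f k x) \<longlonglongrightarrow> indicator U x" for x
  proof (cases "x \<in> U")
    case True
    have "closed (- U)" "- U \<noteq> {}" using U by auto
    then have pos: "0 < infdist x (- U)"
      using True in_closed_iff_infdist_zero[of "- U" x] infdist_nonneg[of x "- U"] by force
    obtain N :: nat where N: "1 < real N * infdist x (- U)"
      using ex_less_of_nat_mult[OF pos] by blast
    have "f k x = 1" if "N \<le> k" for k
    proof -
      have "real N * infdist x (- U) \<le> real k * infdist x (- U)"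
        using that pos by (intro mult_right_mono) auto
      with N show ?thesis by (simp add: f_def)
    qed
    then have "\<forall>\<^sub>F k in sequentially. f k x = 1"
      by (auto simp: eventually_sequentially)
    then show ?thesis using True by (simp add: tendsto_eventually)
  next
    case False
    then show ?thesis by (simp add: f_def)
  qed
  have "(\<lambda>k. \<integral>x. f k x \<partial>Q) \<longlonglongrightarrow> (\<integral>x. indicator U x \<partial>Q)"
  proof (rule integral_dominated_convergence[where w = "\<lambda>_. 1"])
    show "AE x in Q. norm (f k x) \<le> 1" for k
      by (simp add: f_def infdist_nonneg)
  qed (use lim in auto)
  then have "(\<lambda>k. \<integral>x. f k x \<partial>Q) \<longlonglongrightarrow> measure Q U"
    by (simp add: borel_probD(3)[OF Q])
  then have "\<forall>\<^sub>F k in sequentially. c < (\<integral>x. f k x \<partial>Q)"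
    using c by (rule order_tendstoD)
  then obtain k where "c < (\<integral>x. f k x \<partial>Q)"
    by (auto simp: eventually_sequentially)
  with cont nonneg le show thesis by (intro that[of "f k"])
qed

text \<open>
  The half of the portmanteau theorem for open sets: the inequality
  \<open>Q U \<le> liminf (X n U)\<close>, phrased with strict lower bounds.
\<close>

lemma weakly_converges_open_lower:
  fixes U :: "'a::metric_space set"
  assumes conv: "weakly_converges X Q"
    and X: "\<And>n. X n \<in> borel_prob" and Q: "Q \<in> borel_prob"
    and U: "open U" and c: "c < measure Q U"
  shows "\<forall>\<^sub>F n in sequentially. c < measure (X n) U"
proof (cases "U = UNIV")
  \<comment> \<open>Here the complement is empty and there is no distance to it.\<close>
  case True
  have "measure P UNIV = 1" if "P \<in> borel_prob" for P :: "'a measure"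
    using prob_space.prob_space[of P] borel_probD[OF that] by simp
  with True c X Q show ?thesis by simp
next
  case False
  obtain f :: "'a \<Rightarrow> real"
    where f: "continuous_on UNIV f" "\<And>x. 0 \<le> f x" "\<And>x. f x \<le> indicator U x"
      and less: "c < (\<integral>x. f x \<partial>Q)"
    using open_set_continuous_minorant[OF Q U False c] by blast
  have f1: "f x \<le> 1" for x
    using f(3)[of x] by (rule order_trans) (simp add: indicator_def)
  have "bounded (range f)"
    using f(2) f1 by (intro boundedI[of _ 1]) auto
  with conv f(1) have "(\<lambda>n. \<integral>x. f x \<partial>X n) \<longlonglongrightarrow> (\<integral>x. f x \<partial>Q)"
    by (auto simp: weakly_converges_def)
  then have ev: "\<forall>\<^sub>F n in sequentially. c < (\<integral>x. f x \<partial>X n)"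
    using less by (rule order_tendstoD)
  have "(\<integral>x. f x \<partial>X n) \<le> measure (X n) U" for n
  proof -
    interpret prob_space "X n" using borel_probD[OF X] by simp
    note [measurable_cong] = borel_probD(2)[OF X]
    have [measurable]: "U \<in> sets borel" "f \<in> borel_measurable borel"
      using U f(1) by (auto intro: borel_measurable_continuous_onI)
    have "(\<integral>x. f x \<partial>X n) \<le> (\<integral>x. indicator U x \<partial>X n)"
    proof (rule integral_mono)
      show "integrable (X n) f"
        using f(2) f1 by (intro integrable_const_bound[where B = 1]) auto
      show "integrable (X n) (indicator U :: 'a \<Rightarrow> real)"
        by (intro integrable_const_bound[where B = 1]) auto
    qed (rule f(3))
    then show ?thesis by (simp add: borel_probD(3)[OF X])
  qed
  with ev show ?thesis
    by (auto elim!: eventually_mono intro: less_le_trans)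
qed

text \<open>
  A Dini-type statement: for each single measure the mass of \<open>G n\<close> tends to 1, and relative
  compactness makes this uniform over the family.
\<close>

lemma relatively_compact_uniform_exhaustion:
  fixes \<Gamma> :: "'a::metric_space measure set" and G :: "nat \<Rightarrow> 'a set"
  assumes sub: "\<Gamma> \<subseteq> borel_prob" and rc: "relatively_compact_family \<Gamma>"
    and G: "\<And>n. open (G n)" "incseq G" "(\<Union>n. G n) = UNIV" and "0 < \<epsilon>"
  shows "\<exists>n. \<forall>P\<in>\<Gamma>. 1 - \<epsilon> < measure P (G n)"
proof (rule ccontr)
  assume "\<not> ?thesis"
  then have "\<forall>n. \<exists>P. P \<in> \<Gamma> \<and> measure P (G n) \<le> 1 - \<epsilon>"
    by (auto simp: not_less)
  then obtain X where X: "\<And>n. X n \<in> \<Gamma>" "\<And>n. measure (X n) (G n) \<le> 1 - \<epsilon>"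
    by metis
  then obtain r Q where r: "strict_mono r" and Q: "Q \<in> borel_prob"
    and conv: "weakly_converges (X \<circ> r) Q"
    using rc unfolding relatively_compact_family_def by blast
  interpret Q: prob_space Q using borel_probD[OF Q] by simp
  have "(\<lambda>n. measure Q (G n)) \<longlonglongrightarrow> measure Q (\<Union>n. G n)"
    using G by (intro Q.finite_Lim_measure_incseq) (auto simp: borel_probD(2)[OF Q])
  moreover have "measure Q (\<Union>n. G n) = 1"
    using Q.prob_space by (simp add: G(3) borel_probD(3)[OF Q])
  ultimately have "\<forall>\<^sub>F n in sequentially. 1 - \<epsilon> < measure Q (G n)"
    using \<open>0 < \<epsilon>\<close> by (intro order_tendstoD) auto
  then obtain k where k: "1 - \<epsilon> < measure Q (G k)"
    by (auto simp: eventually_sequentially)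
  have "\<forall>\<^sub>F n in sequentially. 1 - \<epsilon> < measure ((X \<circ> r) n) (G k)"
    using conv _ Q G(1) k by (rule weakly_converges_open_lower) (use X sub in auto)
  then obtain N where N: "\<And>n. N \<le> n \<Longrightarrow> 1 - \<epsilon> < measure (X (r n)) (G k)"
    by (auto simp: eventually_sequentially)
  define n where "n = max N k"
  have P: "X (r n) \<in> borel_prob" using X sub by auto
  interpret P: prob_space "X (r n)" using borel_probD[OF P] by simp
  \<comment> \<open>Far along the subsequence the index exceeds \<open>k\<close>, so \<open>G k\<close> lies in a set of mass at most \<open>1 - \<epsilon>\<close>.\<close>
  have "k \<le> r n"
    using seq_suble[OF r, of n] by (simp add: n_def)
  then have "measure (X (r n)) (G k) \<le> measure (X (r n)) (G (r n))"
    using G by (intro P.finite_measure_mono) (auto simp: borel_probD(2)[OF P] dest: incseqD)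
  with X(2)[of "r n"] N[of n] show False by (simp add: n_def)
qed

lemma compact_Inter_finite_cball_unions:
  fixes s :: "nat \<Rightarrow> 'a::complete_space" and N :: "nat \<Rightarrow> nat"
  shows "compact (\<Inter>m. \<Union>i\<le>N m. cball (s i) (1 / real (Suc m)))" (is "compact ?K")
  unfolding compact_eq_totally_bounded complete_eq_closed
proof (intro conjI allI impI)
  show "closed ?K" by (intro closed_INT ballI closed_UN) auto
next
  fix e :: real assume "0 < e"
  then obtain m where m: "1 / real (Suc m) < e"
    using nat_approx_posE by blast
  have "?K \<subseteq> (\<Union>i\<le>N m. cball (s i) (1 / real (Suc m)))" by blast
  also have "\<dots> \<subseteq> (\<Union>x\<in>s ` {..N m}. ball x e)" using m by force
  finally show "\<exists>k. finite k \<and> ?K \<subseteq> (\<Union>x\<in>k. ball x e)"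
    by (intro exI[of _ "s ` {..N m}"]) simp
qed

lemma (in prob_space) prob_Inter_lower:
  assumes A: "\<And>m. A m \<in> events" and c: "c sums s" and le: "\<And>m. 1 - c m \<le> prob (A m)"
  shows "1 - s \<le> prob (\<Inter>m. A m)"
proof -
  have bound: "prob (space M - A m) \<le> c m" for m
    using le[of m] prob_compl[OF A] by simp
  have summ: "summable (\<lambda>m. prob (space M - A m))"
    by (rule summable_comparison_test'[where g = c and N = 0])
      (use c bound in \<open>auto simp: sums_iff\<close>)
  have INT: "(\<Inter>m. A m) \<in> events" using A by auto
  have "1 - prob (\<Inter>m. A m) = prob (space M - (\<Inter>m. A m))"
    using prob_compl[OF INT] by simp
  also have "space M - (\<Inter>m. A m) = (\<Union>m. space M - A m)" by auto
  also have "prob \<dots> \<le> (\<Sum>m. prob (space M - A m))"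
    using A summ by (intro finite_measure_subadditive_countably) auto
  also have "\<dots> \<le> s"
    using suminf_le[OF bound summ] c by (simp add: sums_iff)
  finally show ?thesis by simp
qed

lemma separable_space_dense_sequence:
  assumes "separable_space (euclidean :: 'a::metric_space topology)"
  obtains s :: "nat \<Rightarrow> 'a::metric_space" where "\<And>x e. 0 < e \<Longrightarrow> \<exists>i. x \<in> ball (s i) e"
proof -
  obtain C :: "'a set" where C: "countable C" "closure C = UNIV"
    using assms by (auto simp: separable_space_def)
  then have ne: "C \<noteq> {}" by auto
  have "\<exists>i. x \<in> ball (from_nat_into C i) e" if e: "0 < e" for x e
  proof -
    have "x \<in> closure C" using C by simp
    then obtain y where "y \<in> C" "dist y x < e"
      using e unfolding closure_approachable by blast
    then show ?thesis
      using from_nat_into_surj[OF C(1)] by (metis mem_ball)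
  qed
  then show thesis by (rule that)
qed

theorem theorem3p10:
  fixes \<Gamma> :: "'a::complete_space measure set"
  assumes "separable_space (euclidean :: 'a topology)"
    and "\<Gamma> \<subseteq> borel_prob"
    and "relatively_compact_family \<Gamma>"
  shows "tight_family \<Gamma>"
  unfolding tight_family_def
proof (intro allI impI)
  fix \<epsilon> :: real assume \<epsilon>: "0 < \<epsilon>"
  obtain s :: "nat \<Rightarrow> 'a" where s: "\<And>x e. 0 < e \<Longrightarrow> \<exists>i. x \<in> ball (s i) e"
    using separable_space_dense_sequence[OF assms(1)] by blast
  define c where "c m = \<epsilon> / 2 * (1 / 2) ^ Suc m" for m :: nat
  have c_pos: "0 < c m" for m using \<epsilon> by (simp add: c_def)
  have c_sums: "c sums (\<epsilon> / 2)"
    using sums_mult[OF power_half_series, of "\<epsilon> / 2"] unfolding c_def by simp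
  have "\<exists>n. \<forall>P\<in>\<Gamma>. 1 - c m < measure P (\<Union>i\<le>n. ball (s i) (1 / real (Suc m)))" for m
  proof (rule relatively_compact_uniform_exhaustion[OF assms(2,3) _ _ _ c_pos])
    show "incseq (\<lambda>n. \<Union>i\<le>n. ball (s i) (1 / real (Suc m)))"
      by (intro monoI UN_mono) auto
    show "(\<Union>n. \<Union>i\<le>n. ball (s i) (1 / real (Suc m))) = UNIV"
      using s[of "1 / real (Suc m)"] by fastforce
  qed auto
  then obtain N where
    N: "\<And>m P. P \<in> \<Gamma> \<Longrightarrow> 1 - c m < measure P (\<Union>i\<le>N m. ball (s i) (1 / real (Suc m)))"
    by metis
  define A where "A m = (\<Union>i\<le>N m. cball (s i) (1 / real (Suc m)))" for m
  have "1 - \<epsilon> < measure P (\<Inter>m. A m)" if P: "P \<in> \<Gamma>" for P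
  proof -
    have P': "P \<in> borel_prob" using P assms(2) by auto
    interpret prob_space P using borel_probD[OF P'] by simp
    have A: "A m \<in> events" for m
      unfolding A_def borel_probD(2)[OF P'] by (intro borel_closed closed_UN) auto
    have "1 - c m \<le> prob (A m)" for m
    proof -
      have "prob (\<Union>i\<le>N m. ball (s i) (1 / real (Suc m))) \<le> prob (A m)"
        by (rule finite_measure_mono[OF _ A]) (force simp: A_def)
      with N[OF P, of m] show ?thesis by linarith
    qed
    with prob_Inter_lower[OF A c_sums] have "1 - \<epsilon> / 2 \<le> prob (\<Inter>m. A m)" .
    with \<epsilon> show ?thesis by linarith
  qed
  moreover have "compact (\<Inter>m. A m)"
    unfolding A_def by (rule compact_Inter_finite_cball_unions)
  ultimately show "\<exists>K. compact K \<and> (\<forall>P\<in>\<Gamma>. measure P K > 1 - \<epsilon>)" by blast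
qed

end
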